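(* Let $G$ be a finitely generated, contracting, regular branch group acting on the $d$-adic rooted tree, branching over its normal subgroup $K$ of finite index $k$. Let $\{t_1,\dots,t_k\}$ be a left transversal for $K$ in $G$ and let $\{s_1,\dots,s_\ell\}$ be a left transversal for $\psi^{-1}(K\times\dots\times K)$ in $K$. For $n\ge 0$ put $p_n(t_i)=|\{g\in t_iK\mid d(g)\leq n\}|$ and $p_n=|\{g\in G\mid d(g)\leq n\}|$. For $i=1,\dots,k$ and $j=1,\dots,\ell$ write $t_is_j=(g_1,\dots,g_d)\alpha$ and let $t_{ij1},\dots,t_{ijd}\in\{t_1,\dots,t_k\}$ be the transversal elements such that $g_r\in t_{ijr}K$ for $r=1,\dots,d$. Then, for all $n \geq 0$, $$p_{n+1}(t_i)=\sum_{j=1}^\ell p_{n}(t_{ij1})\cdots p_{n}(t_{ijd})\quad (i=1,\dots,k),\qquad p_{n+1}=\sum_{i=1}^k\sum_{j=1}^\ell p_{n}(t_{ij1})\cdots p_{n}(t_{ijd}),$$ with initial conditions: $p_0(t_i)$ is the number of elements of the nucleus of $G$ lying in $t_iK$, and $p_0$ is the size of the nucleus.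
   Context: Let $X=\{1,\dots,d\}$ and let $T$ be the $d$-adic rooted tree whose vertices are the finite words over $X$, with $u$ joined to $ux$ for $x \in X$; words of length $n$ form level $n$. $\operatorname{Aut} T$ is the group of automorphisms of this rooted tree. Every $g\in\operatorname{Aut} T$ is written $g=(g_1,\dots,g_d)\alpha$ with $\alpha\in S_d$ and $g_i\in \operatorname{Aut} T$, meaning $g(iw)=\alpha(i)\,g_i(w)$ for $i\in X$ and every word $w$; $g_i$ is the section of $g$ at $i$. The section $g_u$ at any vertex $u$ is defined by $g(uw)=g(u)g_u(w)$. Products are composed so that $gh$ means first $g$, then $h$, i.e. $(gh)_u=g_u h_{g(u)}$. A group $G\le\operatorname{Aut} T$ is self-similar if all sections of its elements lie in $G$. A self-similar group $G$ is contracting if there is a finite set $\mathcal{M}\subseteq G$ such that for every $g\in G$ there is a level $n$ such that all sections of $g$ at vertices at and below level $n$ belong to $\mathcal{M}$. The smallest such $\mathcal{M}$ is the nucleus $\mathcal{N}(G)$. For a contracting group $G$, the nucleus portrait of $g\in G$ is the finite decorated rooted tree defined recursively: if $g\in\mathcal{N}(G)$, it is a single root decorated by $g$; otherwise, with $g=(g_1,\dots,g_d)\alpha$, the root is decorated by $\alpha$ and the portraits of $g_1,\dots,g_d$ are attached at the $d$ vertices of level 1. The depth $d(g)$ is the length of the longest path from the root to a leaf of the portrait (equivalently, the least $n$ such that all sections of $g$ at level $n$ lie in $\mathcal{N}(G)$). For a finitely generated contracting group, the sets $\{g\in G\mid d(g)\le n\}$ are finite. $\operatorname{st}_G(1)$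 is the subgroup of elements of $G$ fixing all vertices of level 1, and $\psi:\operatorname{st}_G(1)\to \operatorname{Aut} T\times\dots\times\operatorname{Aut} T$ ($d$ factors) is the injective homomorphism $g\mapsto(g_1,\dots,g_d)$. A group $G\le\operatorname{Aut}T$ that acts transitively on every level is called regular branch, branching over $K$, if $K$ is a normal subgroup of finite index in $G$ with $\psi(K\cap\operatorname{st}_G(1))\geq K\times\dots\times K$. In that case $\psi^{-1}(K\times\dots\times K)$ is a finite index subgroup of $K$. *)

theory Defs
  imports "HOL-Algebra.Left_Coset" "HOL-Algebra.Generated_Groups"
begin

text \<open>
  The alphabet \<open>X = {1,\<dots>,d}\<close> is a finite type \<open>'x\<close>, so \<open>d = CARD('x)\<close>, and the vertices of
  the tree are all the words in \<open>'x list\<close>. A \<open>d\<close>-tuple indexed by \<open>X\<close> is a function on \<open>'x\<close>.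
\<close>

type_synonym 'x tmap = "'x list \<Rightarrow> 'x list"

definition tree_adj :: "'x list \<Rightarrow> 'x list \<Rightarrow> bool" where
  "tree_adj u v \<longleftrightarrow> (\<exists>x. v = u @ [x]) \<or> (\<exists>x. u = v @ [x])"

definition tree_automorphism :: "'x tmap \<Rightarrow> bool" where
  "tree_automorphism g \<longleftrightarrow>
     bij g \<and> g [] = [] \<and> (\<forall>u v. tree_adj (g u) (g v) \<longleftrightarrow> tree_adj u v)"

text \<open>The product \<open>gh\<close> acts by first \<open>g\<close>, then \<open>h\<close>.\<close>

definition AutT :: "'x tmap monoid" where
  "AutT = \<lparr>carrier = {g. tree_automorphism g}, mult = (\<lambda>g h. h \<circ> g), one = id\<rparr>"

text \<open>
  For a tree automorphism \<open>g\<close>, the word \<open>g u\<close> is the prefix of length \<open>length u\<close> of \<open>g (u @ w)\<close>,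
  so the two definitions below amount to \<open>g (u @ w) = g u @ tree_section g u w\<close> and
  \<open>g [x] = [root_perm g x]\<close>.
\<close>

definition tree_section :: "'x tmap \<Rightarrow> 'x list \<Rightarrow> 'x tmap" where
  "tree_section g u = (\<lambda>w. drop (length u) (g (u @ w)))"

definition root_perm :: "'x tmap \<Rightarrow> 'x \<Rightarrow> 'x" where
  "root_perm g x = hd (g [x])"

definition finitely_generated :: "'x tmap set \<Rightarrow> bool" where
  "finitely_generated G \<longleftrightarrow> (\<exists>S. finite S \<and> S \<subseteq> carrier AutT \<and> G = generate AutT S)"

definition self_similar :: "'x tmap set \<Rightarrow> bool" where
  "self_similar G \<longleftrightarrow> (\<forall>g\<in>G. \<forall>u. tree_section g u \<in> G)"

definition contracts_to :: "'x tmap set \<Rightarrow> 'x tmap set \<Rightarrow> bool" where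
  "contracts_to G M \<longleftrightarrow>
     finite M \<and> M \<subseteq> G \<and> (\<forall>g\<in>G. \<exists>n. \<forall>u. n \<le> length u \<longrightarrow> tree_section g u \<in> M)"

definition contracting :: "'x tmap set \<Rightarrow> bool" where
  "contracting G \<longleftrightarrow> self_similar G \<and> (\<exists>M. contracts_to G M)"

definition nucleus :: "'x tmap set \<Rightarrow> 'x tmap set" where
  "nucleus G = (LEAST M. contracts_to G M)"

datatype ('x, 'g) portrait =
    Leaf 'g
  | Node "'x \<Rightarrow> 'x" "'x \<Rightarrow> ('x, 'g) portrait"

primrec height :: "('x::finite, 'g) portrait \<Rightarrow> nat" where
  "height (Leaf g) = 0"
| "height (Node a P) = Suc (Max (range (\<lambda>x. height (P x))))"

text \<open>
  The recursion defining the portrait of \<open>g\<close> terminates only because \<open>G\<close> is contracting, hence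
  an inductive relation, whose unique second component is taken in \<open>depth\<close>.
\<close>

inductive is_portrait :: "'x tmap set \<Rightarrow> 'x tmap \<Rightarrow> ('x, 'x tmap) portrait \<Rightarrow> bool"
  for G where
    leaf: "g \<in> nucleus G \<Longrightarrow> is_portrait G g (Leaf g)"
  | node: "g \<notin> nucleus G \<Longrightarrow> (\<And>x. is_portrait G (tree_section g [x]) (P x)) \<Longrightarrow>
           is_portrait G g (Node (root_perm g) P)"

definition depth :: "('x::finite) tmap set \<Rightarrow> 'x tmap \<Rightarrow> nat" where
  "depth G g = height (THE P. is_portrait G g P)"

definition level_transitive :: "'x tmap set \<Rightarrow> bool" where
  "level_transitive G \<longleftrightarrow> (\<forall>u v. length u = length v \<longrightarrow> (\<exists>g\<in>G. g u = v))"

definition st1 :: "'x tmap set \<Rightarrow> 'x tmap set" where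
  "st1 G = {g \<in> G. \<forall>u. length u = 1 \<longrightarrow> g u = u}"

definition psi :: "'x tmap \<Rightarrow> 'x \<Rightarrow> 'x tmap" where
  "psi g = (\<lambda>x. tree_section g [x])"

text \<open>The set underlying \<open>K \<times> \<dots> \<times> K\<close>, with one factor for each letter.\<close>

definition dpower :: "'x tmap set \<Rightarrow> ('x \<Rightarrow> 'x tmap) set" where
  "dpower K = {f. \<forall>x. f x \<in> K}"

definition psi_preimage :: "'x tmap set \<Rightarrow> 'x tmap set \<Rightarrow> 'x tmap set" where
  "psi_preimage G K = {g \<in> st1 G. psi g \<in> dpower K}"

definition regular_branch_over :: "'x tmap set \<Rightarrow> 'x tmap set \<Rightarrow> bool" where
  "regular_branch_over G K \<longleftrightarrow>
     level_transitive G \<and>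
     K \<lhd> AutT\<lparr>carrier := G\<rparr> \<and>
     finite (rcosets\<^bsub>AutT\<lparr>carrier := G\<rparr>\<^esub> K) \<and>
     dpower K \<subseteq> psi ` (K \<inter> st1 G)"

text \<open>\<open>t 1, \<dots>, t m\<close> represent each left coset of \<open>H\<close> in \<open>A\<close> exactly once.\<close>

definition left_transversal :: "'x tmap set \<Rightarrow> 'x tmap set \<Rightarrow> nat \<Rightarrow> (nat \<Rightarrow> 'x tmap) \<Rightarrow> bool" where
  "left_transversal A H m t \<longleftrightarrow>
     t ` {1..m} \<subseteq> A \<and>
     bij_betw (\<lambda>i. t i <#\<^bsub>AutT\<^esub> H) {1..m} (lcosets\<^bsub>AutT\<lparr>carrier := A\<rparr>\<^esub> H)"

definition growth :: "('x::finite) tmap set \<Rightarrow> nat \<Rightarrow> nat" where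
  "growth G n = card {g \<in> G. depth G g \<le> n}"

definition coset_growth :: "('x::finite) tmap set \<Rightarrow> 'x tmap set \<Rightarrow> nat \<Rightarrow> 'x tmap \<Rightarrow> nat" where
  "coset_growth G K n a = card {g \<in> a <#\<^bsub>AutT\<^esub> K. depth G g \<le> n}"

end

theory Submission
  imports Defs "HOL-Library.Disjoint_Sets"
begin

text \<open>
  Put \<open>H = \<psi>\<^sup>-\<^sup>1(K \<times> \<dots> \<times> K)\<close>, so that \<open>t\<^sub>iK\<close> is the disjoint union of the cosets \<open>t\<^sub>is\<^sub>jH\<close>.
  Since \<open>K \<times> \<dots> \<times> K \<le> \<psi>(K \<inter> st\<^sub>G(1))\<close>, taking first level sections is a bijection from
  \<open>t\<^sub>is\<^sub>jH\<close> onto the product of the cosets \<open>t\<^sub>i\<^sub>j\<^sub>rK\<close>. The nucleus is closed under sections, so an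
  element has depth at most \<open>n + 1\<close> exactly when all its first level sections have depth at
  most \<open>n\<close>.
\<close>

section \<open>Tree automorphisms, sections and root permutations\<close>

lemma tree_automorphism_snoc:
  assumes "tree_automorphism g"
  shows "\<exists>y. g (u @ [x]) = g u @ [y]"
proof (induction u arbitrary: x rule: rev_induct)
  case Nil
  have "tree_adj (g []) (g [x])"
    using assms unfolding tree_automorphism_def tree_adj_def by blast
  then show ?case
    using assms by (simp add: tree_automorphism_def tree_adj_def)
next
  case (snoc z v)
  obtain z' where z': "g (v @ [z]) = g v @ [z']" using snoc by blast
  have "tree_adj (g (v @ [z])) (g ((v @ [z]) @ [x]))"
    using assms unfolding tree_automorphism_def tree_adj_def by blast
  \<comment> \<open>Adjacency alone would allow the image to move up to the parent of
    \<open>g (v @ [z])\<close>. By induction that parent is \<open>g v\<close>, so injectivity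
    excludes it.\<close>
  moreover have "g (v @ [z]) \<noteq> g ((v @ [z]) @ [x]) @ [y]" for y
  proof
    assume "g (v @ [z]) = g ((v @ [z]) @ [x]) @ [y]"
    then have "g v = g ((v @ [z]) @ [x])" using z' by simp
    moreover have "inj g" using assms by (simp add: tree_automorphism_def bij_is_inj)
    ultimately show False by (simp add: inj_eq)
  qed
  ultimately show ?case unfolding tree_adj_def by blast
qed

lemma length_tree_automorphism:
  assumes "tree_automorphism g"
  shows "length (g u) = length u"
proof (induction u rule: rev_induct)
  case Nil
  then show ?case using assms by (simp add: tree_automorphism_def)
next
  case (snoc x u)
  then show ?case using tree_automorphism_snoc[OF assms, of u x] by auto
qed

lemma tree_automorphism_append:
  assumes "tree_automorphism g"
  shows "g (u @ w) = g u @ tree_section g u w"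
proof -
  have "\<exists>v. g (u @ w) = g u @ v"
  proof (induction w rule: rev_induct)
    case (snoc x w)
    then show ?case using tree_automorphism_snoc[OF assms, of "u @ w" x] by auto
  qed simp
  then show ?thesis
    using length_tree_automorphism[OF assms, of u] by (auto simp: tree_section_def)
qed

lemma tree_automorphism_Cons:
  assumes "tree_automorphism g"
  shows "g (x # w) = root_perm g x # tree_section g [x] w"
proof -
  have "g [x] = [root_perm g x]"
    using length_tree_automorphism[OF assms, of "[x]"]
    by (auto simp: root_perm_def length_Suc_conv)
  then show ?thesis
    using tree_automorphism_append[OF assms, of "[x]" w] by simp
qed

text \<open>Injectivity of the wreath recursion: the image of a nonempty word is read off from the
  root permutation and the section at its first letter. On the stabiliser of level 1 this becomes
  injectivity of \<open>psi\<close>.\<close>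

lemma tree_automorphism_eqI:
  assumes "tree_automorphism g" "tree_automorphism h"
    and "root_perm g = root_perm h" "psi g = psi h"
  shows "g = h"
proof
  fix u
  show "g u = h u"
  proof (cases u)
    case Nil
    then show ?thesis using assms by (simp add: tree_automorphism_def)
  next
    case (Cons x w)
    then show ?thesis
      using assms by (simp add: tree_automorphism_Cons psi_def fun_eq_iff)
  qed
qed

lemma inj_root_perm:
  assumes "tree_automorphism g"
  shows "inj (root_perm g)"
proof (rule injI)
  fix x y
  assume eq: "root_perm g x = root_perm g y"
  have "length (g [x]) = length [x]" "length (g [y]) = length [y]"
    using length_tree_automorphism[OF assms] by blast+
  with eq have "g [x] = g [y]"
    by (auto simp: root_perm_def length_Suc_conv)
  moreover have "inj g" using assms by (simp add: tree_automorphism_def bij_is_inj)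
  ultimately show "x = y" by (simp add: inj_eq)
qed

lemma tree_section_Nil [simp]: "tree_section g [] = g"
  by (simp add: tree_section_def)

lemma tree_section_append:
  "tree_section (tree_section g u) v = tree_section g (u @ v)"
  by (simp add: tree_section_def fun_eq_iff add.commute)

lemma tree_automorphism_comp:
  "tree_automorphism g \<Longrightarrow> tree_automorphism h \<Longrightarrow> tree_automorphism (h \<circ> g)"
  by (auto simp: tree_automorphism_def intro: bij_comp)

lemma tree_automorphism_inv:
  assumes "tree_automorphism g"
  shows "tree_automorphism (inv_into UNIV g)"
proof -
  have b: "bij g" and adj: "\<And>u v. tree_adj (g u) (g v) \<longleftrightarrow> tree_adj u v" and "g [] = []"
    using assms by (auto simp: tree_automorphism_def)
  have "tree_adj (inv_into UNIV g u) (inv_into UNIV g v) \<longleftrightarrow> tree_adj u v" for u v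
    using adj[of "inv_into UNIV g u" "inv_into UNIV g v"] b by (simp add: bij_is_surj surj_f_inv_f)
  moreover have "inv_into UNIV g [] = []"
    using b \<open>g [] = []\<close> by (metis bij_is_inj inv_f_f)
  ultimately show ?thesis
    using b by (simp add: tree_automorphism_def bij_imp_bij_inv)
qed

section \<open>The group of tree automorphisms and its wreath recursion\<close>

lemma carrier_AutT [simp]: "g \<in> carrier AutT \<longleftrightarrow> tree_automorphism g"
  and mult_AutT [simp]: "g \<otimes>\<^bsub>AutT\<^esub> h = h \<circ> g"
  and one_AutT [simp]: "\<one>\<^bsub>AutT\<^esub> = id"
  by (simp_all add: AutT_def)

lemma group_AutT: "group AutT"
proof (rule groupI)
  fix g :: "'a tmap"
  assume "g \<in> carrier AutT"
  then have g: "tree_automorphism g" by simp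
  \<comment> \<open>Products act from left to right, so this left inverse law reads
    \<open>g \<circ> inv_into UNIV g = id\<close>, which is surjectivity of
    \<open>g\<close>.\<close>
  then have "inv_into UNIV g \<otimes>\<^bsub>AutT\<^esub> g = \<one>\<^bsub>AutT\<^esub>"
    by (simp add: tree_automorphism_def bij_is_surj flip: surj_iff)
  with tree_automorphism_inv[OF g] show "\<exists>h\<in>carrier AutT. h \<otimes>\<^bsub>AutT\<^esub> g = \<one>\<^bsub>AutT\<^esub>"
    by (meson carrier_AutT)
qed (auto simp: tree_automorphism_comp comp_assoc, simp add: tree_automorphism_def)

lemma root_perm_mult:
  assumes "tree_automorphism g" "tree_automorphism h"
  shows "root_perm (g \<otimes>\<^bsub>AutT\<^esub> h) x = root_perm h (root_perm g x)"
  using assms tree_automorphism_Cons[OF assms(1), of x "[]"]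
    tree_automorphism_Cons[OF assms(2), of "root_perm g x"]
  by (simp add: root_perm_def[of "h \<circ> g"])

text \<open>Since \<open>g\<close> acts first, \<open>h\<close> meets the letter already moved by
  \<open>g\<close>. This shift of the index vanishes on the stabiliser of level 1, but has to be
  undone when a tuple of sections is prescribed on a coset.\<close>

lemma psi_mult:
  assumes "tree_automorphism g" "tree_automorphism h"
  shows "psi (g \<otimes>\<^bsub>AutT\<^esub> h) x = psi g x \<otimes>\<^bsub>AutT\<^esub> psi h (root_perm g x)"
  using assms
  by (auto simp: fun_eq_iff psi_def tree_section_def[of "h \<circ> g"] tree_automorphism_Cons)

lemma psi_id: "psi id = (\<lambda>x. id)"
  by (simp add: psi_def tree_section_def fun_eq_iff)

section \<open>The stabiliser of level 1 and the preimage of the power of \<open>K\<close>\<close>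

lemma st1_iff_root_perm:
  assumes "G \<subseteq> carrier AutT"
  shows "g \<in> st1 G \<longleftrightarrow> g \<in> G \<and> root_perm g = id"
proof (cases "g \<in> G")
  case True
  then have "tree_automorphism g" using assms by auto
  then have "length (g [x]) = 1" for x by (simp add: length_tree_automorphism)
  then have "(g [x] = [x]) \<longleftrightarrow> root_perm g x = x" for x
    by (metis One_nat_def length_0_conv length_Suc_conv list.sel(1) root_perm_def)
  then show ?thesis using True by (auto simp: st1_def fun_eq_iff length_Suc_conv)
qed (simp add: st1_def)

text \<open>Where the root permutation is trivial, \<open>psi\<close> is multiplicative in each
  coordinate, so closure is inherited from \<open>G\<close> and \<open>K\<close>.\<close>

lemma subgroup_psi_preimage:
  assumes G: "subgroup G AutT" and K: "subgroup K AutT"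
  shows "subgroup (psi_preimage G K) AutT"
proof -
  interpret A: group AutT by (rule group_AutT)
  have Gc: "G \<subseteq> carrier AutT" using G by (rule subgroup.subset)
  note st = st1_iff_root_perm[OF Gc]
  show ?thesis
  proof (rule A.subgroupI)
    show "psi_preimage G K \<subseteq> carrier AutT"
      using Gc by (auto simp: psi_preimage_def st)
    have "id \<in> G" "id \<in> K" using G K subgroup.one_closed by fastforce+
    then have "id \<in> psi_preimage G K"
      by (simp add: psi_preimage_def dpower_def psi_id st1_def)
    then show "psi_preimage G K \<noteq> {}" by blast
  next
    fix g h
    assume "g \<in> psi_preimage G K" "h \<in> psi_preimage G K"
    then have g: "g \<in> G" "root_perm g = id" "\<And>x. psi g x \<in> K"
      and h: "h \<in> G" "root_perm h = id" "\<And>x. psi h x \<in> K"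
      by (auto simp: psi_preimage_def dpower_def st)
    have "tree_automorphism g" "tree_automorphism h" using g h Gc by auto
    note mult = root_perm_mult[OF this] psi_mult[OF this]
    show "g \<otimes>\<^bsub>AutT\<^esub> h \<in> psi_preimage G K"
      using g h subgroup.m_closed[OF G g(1) h(1)] subgroup.m_closed[OF K g(3) h(3)]
      by (simp add: psi_preimage_def dpower_def st fun_eq_iff mult del: mult_AutT)
  next
    fix g
    assume "g \<in> psi_preimage G K"
    then have g: "g \<in> G" "root_perm g = id" "\<And>x. psi g x \<in> K"
      by (auto simp: psi_preimage_def dpower_def st)
    let ?i = "inv\<^bsub>AutT\<^esub> g"
    have i: "?i \<in> G" using G g(1) by (rule subgroup.m_inv_closed)
    have ag: "tree_automorphism g" and ai: "tree_automorphism ?i" using g i Gc by auto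
    have one: "g \<otimes>\<^bsub>AutT\<^esub> ?i = id" using ag A.r_inv[of g] by simp
    have "root_perm ?i x = x" for x
      using root_perm_mult[OF ag ai, of x] g(2) unfolding one by (simp add: root_perm_def)
    moreover have "psi ?i x \<in> K" for x
    proof -
      let ?q = "inv\<^bsub>AutT\<^esub> (psi g x)"
      have "psi g x \<in> carrier AutT" using g(3) K subgroup.subset by blast
      then have "psi g x \<circ> ?q = id" using A.l_inv by fastforce
      moreover have "psi ?i x \<circ> psi g x = id"
        using psi_mult[OF ag ai, of x] g(2) unfolding one by (simp add: psi_id)
      \<comment> \<open>Under composition \<open>psi ?i x\<close> is a left inverse and
        \<open>?q\<close> a right inverse of \<open>psi g x\<close>, so the two agree.\<close>
      ultimately have "psi ?i x = ?q" by (metis comp_assoc comp_id id_comp)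
      then show ?thesis using subgroup.m_inv_closed[OF K g(3)] by simp
    qed
    ultimately show "?i \<in> psi_preimage G K"
      using i by (simp add: psi_preimage_def dpower_def st fun_eq_iff)
  qed
qed

text \<open>Branching yields an element of \<open>K\<close> that fixes level 1 and has the same
  first level sections as \<open>g\<close>; by injectivity of \<open>psi\<close> on the stabiliser
  it is \<open>g\<close>. Hence the preimage, although formed inside \<open>G\<close>, has a coset
  decomposition inside \<open>K\<close>.\<close>

lemma psi_preimage_subset:
  assumes G: "G \<subseteq> carrier AutT" and "regular_branch_over G K"
  shows "psi_preimage G K \<subseteq> K"
proof
  fix g
  assume "g \<in> psi_preimage G K"
  then have g: "g \<in> st1 G" and "psi g \<in> dpower K" by (auto simp: psi_preimage_def)
  then obtain h where h: "h \<in> K" "h \<in> st1 G" "psi g = psi h"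
    using assms(2) by (auto simp: regular_branch_over_def)
  have "g = h"
    using g h G by (intro tree_automorphism_eqI) (auto simp: st1_iff_root_perm[OF G])
  then show "g \<in> K" using h by simp
qed

section \<open>Partitions into left cosets\<close>

lemma (in group) l_coset_disjoint:
  assumes H: "subgroup H G" and "x \<in> carrier G" "y \<in> carrier G" "x <# H \<noteq> y <# H"
  shows "(x <# H) \<inter> (y <# H) = {}"
proof (rule ccontr)
  assume "(x <# H) \<inter> (y <# H) \<noteq> {}"
  then obtain z where "z \<in> x <# H" "z \<in> y <# H" by blast
  then have "x <# H = z <# H" "y <# H = z <# H"
    using l_repr_independence[OF _ _ H] assms(2,3) by blast+
  then show False using assms(4) by simp
qed

text \<open>Turns a bijection with the set of cosets into a disjoint union, the form needed for
  counting. It serves both for \<open>K\<close> in \<open>G\<close> and for the preimage in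
  \<open>K\<close>.\<close>

lemma left_transversal_partition:
  assumes A: "subgroup A AutT" and H: "subgroup H AutT" and "H \<subseteq> A"
    and t: "left_transversal A H m t"
  shows "A = (\<Union>i\<in>{1..m}. t i <#\<^bsub>AutT\<^esub> H)"
    and "disjoint_family_on (\<lambda>i. t i <#\<^bsub>AutT\<^esub> H) {1..m}"
proof -
  interpret A: group AutT by (rule group_AutT)
  have sub: "A \<subseteq> carrier AutT" using A by (rule subgroup.subset)
  have b: "bij_betw (\<lambda>i. t i <#\<^bsub>AutT\<^esub> H) {1..m} (lcosets\<^bsub>AutT\<lparr>carrier := A\<rparr>\<^esub> H)"
    and tA: "\<And>i. i \<in> {1..m} \<Longrightarrow> t i \<in> A"
    using t by (auto simp: left_transversal_def)
  \<comment> \<open>Restricting the carrier leaves the multiplication unchanged, so cosets in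
    \<open>A\<close> can be computed in \<open>AutT\<close>.\<close>
  have cosets: "lcosets\<^bsub>AutT\<lparr>carrier := A\<rparr>\<^esub> H = (\<lambda>a. a <#\<^bsub>AutT\<^esub> H) ` A"
    by (auto simp: LCOSETS_def l_coset_def)
  have "(\<Union>i\<in>{1..m}. t i <#\<^bsub>AutT\<^esub> H) = (\<Union>a\<in>A. a <#\<^bsub>AutT\<^esub> H)"
    using bij_betw_imp_surj_on[OF b] unfolding cosets by metis
  also have "\<dots> = A"
  proof
    show "(\<Union>a\<in>A. a <#\<^bsub>AutT\<^esub> H) \<subseteq> A"
      using \<open>H \<subseteq> A\<close> subgroup.m_closed[OF A] by (fastforce simp: l_coset_def)
    show "A \<subseteq> (\<Union>a\<in>A. a <#\<^bsub>AutT\<^esub> H)"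
    proof
      fix a
      assume "a \<in> A"
      moreover have "a \<in> a <#\<^bsub>AutT\<^esub> H"
        using subgroup.one_closed[OF H] by (auto simp: l_coset_def intro!: bexI[of _ id])
      ultimately show "a \<in> (\<Union>a\<in>A. a <#\<^bsub>AutT\<^esub> H)" by blast
    qed
  qed
  finally show "A = (\<Union>i\<in>{1..m}. t i <#\<^bsub>AutT\<^esub> H)" by simp
  show "disjoint_family_on (\<lambda>i. t i <#\<^bsub>AutT\<^esub> H) {1..m}"
    unfolding disjoint_family_on_def
  proof (intro ballI impI)
    fix i j
    assume ij: "i \<in> {1..m}" "j \<in> {1..m}" "i \<noteq> j"
    then have "t i <#\<^bsub>AutT\<^esub> H \<noteq> t j <#\<^bsub>AutT\<^esub> H"
      using bij_betw_imp_inj_on[OF b] by (meson inj_on_def)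
    then show "(t i <#\<^bsub>AutT\<^esub> H) \<inter> (t j <#\<^bsub>AutT\<^esub> H) = {}"
      using ij tA sub by (intro A.l_coset_disjoint[OF H]) blast+
  qed
qed

text \<open>Left multiplication by \<open>a\<close> is injective on \<open>K\<close> and carries
  each coset of \<open>H\<close> to a coset of \<open>H\<close>, so it transports a partition of
  \<open>K\<close> to one of its translate.\<close>

lemma l_coset_partition:
  assumes "a \<in> carrier AutT" "K \<subseteq> carrier AutT" "H \<subseteq> carrier AutT" "s ` I \<subseteq> carrier AutT"
    and K: "K = (\<Union>i\<in>I. s i <#\<^bsub>AutT\<^esub> H)"
    and disj: "disjoint_family_on (\<lambda>i. s i <#\<^bsub>AutT\<^esub> H) I"
  shows "a <#\<^bsub>AutT\<^esub> K = (\<Union>i\<in>I. (a \<otimes>\<^bsub>AutT\<^esub> s i) <#\<^bsub>AutT\<^esub> H)"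
    and "disjoint_family_on (\<lambda>i. (a \<otimes>\<^bsub>AutT\<^esub> s i) <#\<^bsub>AutT\<^esub> H) I"
proof -
  interpret A: group AutT by (rule group_AutT)
  have assoc: "(a \<otimes>\<^bsub>AutT\<^esub> s i) <#\<^bsub>AutT\<^esub> H = (\<lambda>g. a \<otimes>\<^bsub>AutT\<^esub> g) ` (s i <#\<^bsub>AutT\<^esub> H)" for i
    by (simp add: l_coset_def image_UN comp_assoc)
  show "a <#\<^bsub>AutT\<^esub> K = (\<Union>i\<in>I. (a \<otimes>\<^bsub>AutT\<^esub> s i) <#\<^bsub>AutT\<^esub> H)"
    unfolding assoc by (subst K) (auto simp: l_coset_def)
  have "inj_on (\<lambda>g. a \<otimes>\<^bsub>AutT\<^esub> g) K"
    using assms(1,2) A.inj_on_cmult inj_on_subset by blast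
  note inj = inj_on_image_Int[OF this, symmetric]
  show "disjoint_family_on (\<lambda>i. (a \<otimes>\<^bsub>AutT\<^esub> s i) <#\<^bsub>AutT\<^esub> H) I"
    unfolding assoc disjoint_family_on_def
  proof (intro ballI impI)
    fix i j
    assume ij: "i \<in> I" "j \<in> I" "i \<noteq> j"
    then have "s i <#\<^bsub>AutT\<^esub> H \<subseteq> K" "s j <#\<^bsub>AutT\<^esub> H \<subseteq> K"
      by (subst K, blast)+
    note inj[OF this]
    also have "(s i <#\<^bsub>AutT\<^esub> H) \<inter> (s j <#\<^bsub>AutT\<^esub> H) = {}"
      using disj ij by (simp add: disjoint_family_on_def)
    finally show "(\<lambda>g. a \<otimes>\<^bsub>AutT\<^esub> g) ` (s i <#\<^bsub>AutT\<^esub> H) \<inter> (\<lambda>g. a \<otimes>\<^bsub>AutT\<^esub> g) ` (s j <#\<^bsub>AutT\<^esub> H) = {}"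
      by (simp only: image_empty)
  qed
qed

section \<open>The nucleus\<close>

lemma contracts_to_Int:
  assumes "contracts_to G M" "contracts_to G N"
  shows "contracts_to G (M \<inter> N)"
  unfolding contracts_to_def
proof (intro conjI ballI)
  fix g
  assume "g \<in> G"
  then obtain m n where "\<And>u. m \<le> length u \<Longrightarrow> tree_section g u \<in> M"
    "\<And>u. n \<le> length u \<Longrightarrow> tree_section g u \<in> N"
    using assms unfolding contracts_to_def by meson
  then show "\<exists>n. \<forall>u. n \<le> length u \<longrightarrow> tree_section g u \<in> M \<inter> N"
    by (intro exI[of _ "max m n"]) simp
qed (use assms in \<open>auto simp: contracts_to_def\<close>)

text \<open>An admissible set of minimal cardinality is least: its intersection with any other
  admissible set is admissible and, by minimality, not smaller. This gives \<open>LEAST\<close> its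
  intended meaning.\<close>

lemma nucleus_least:
  assumes "contracting G"
  shows "contracts_to G (nucleus G)"
    and "contracts_to G M \<Longrightarrow> nucleus G \<subseteq> M"
proof -
  obtain N where N: "contracts_to G N" and min: "\<And>M. contracts_to G M \<Longrightarrow> card N \<le> card M"
    using assms ex_has_least_nat[of "contracts_to G" _ card] unfolding contracting_def by metis
  have sub: "N \<subseteq> M" if "contracts_to G M" for M
  proof -
    have "N \<inter> M = N"
      using N min[OF contracts_to_Int[OF N that]]
      by (intro card_seteq) (auto simp: contracts_to_def)
    then show ?thesis by blast
  qed
  then have "nucleus G = N"
    unfolding nucleus_def using N by (intro Least_equality)
  then show "contracts_to G (nucleus G)" "contracts_to G M \<Longrightarrow> nucleus G \<subseteq> M"
    using N sub by auto
qed

text \<open>The nucleus elements whose sections all stay in the nucleus already form a set to which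
  \<open>G\<close> contracts. Since the nucleus is least, it is contained in that set.\<close>

lemma nucleus_section:
  assumes "contracting G" "g \<in> nucleus G"
  shows "tree_section g u \<in> nucleus G"
proof -
  let ?N = "{h \<in> nucleus G. \<forall>u. tree_section h u \<in> nucleus G}"
  have N: "contracts_to G (nucleus G)" using assms(1) by (rule nucleus_least)
  have "contracts_to G ?N"
    unfolding contracts_to_def
  proof (intro conjI ballI)
    fix h
    assume "h \<in> G"
    then obtain n where "\<And>u. n \<le> length u \<Longrightarrow> tree_section h u \<in> nucleus G"
      using N unfolding contracts_to_def by meson
    \<comment> \<open>The same level works, because sections of sections at depth \<open>n\<close>
      or more are sections at still deeper vertices.\<close>
    then show "\<exists>n. \<forall>u. n \<le> length u \<longrightarrow> tree_section h u \<in> ?N"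
      by (intro exI[of _ n]) (simp add: tree_section_append)
  qed (use N in \<open>auto simp: contracts_to_def\<close>)
  then show ?thesis using nucleus_least(2)[OF assms(1)] assms(2) by blast
qed

section \<open>Portraits and depth\<close>

lemma is_portrait_unique:
  "is_portrait G g P \<Longrightarrow> is_portrait G g Q \<Longrightarrow> P = Q"
proof (induction arbitrary: Q rule: is_portrait.induct)
  case (leaf g)
  \<comment> \<open>Membership in the nucleus decides which of the two rules can have produced
    \<open>Q\<close>.\<close>
  from leaf(2,1) show ?case by cases auto
next
  case (node g P)
  from node.prems node.hyps(1) obtain P' where
    "Q = Node (root_perm g) P'" "\<And>x. is_portrait G (tree_section g [x]) (P' x)"
    by cases auto
  then show ?case using node.IH by blast
qed

text \<open>Induction on a level from which on all sections lie in the nucleus; passing to a first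
  level section lowers it by one.\<close>

lemma is_portrait_exists:
  assumes "contracting G" "g \<in> G"
  shows "\<exists>P. is_portrait G g P"
proof -
  have N: "contracts_to G (nucleus G)" using assms(1) by (rule nucleus_least)
  obtain n where "\<And>u. n \<le> length u \<Longrightarrow> tree_section g u \<in> nucleus G"
    using N assms(2) unfolding contracts_to_def by meson
  then show ?thesis
  proof (induction n arbitrary: g)
    case 0
    then have "g \<in> nucleus G" using tree_section_Nil[of g] by (metis zero_le)
    then show ?case by (blast intro: is_portrait.leaf)
  next
    case (Suc n)
    have "\<exists>P. is_portrait G (tree_section g [x]) P" for x
      using Suc.IH[of "tree_section g [x]"] Suc.prems by (simp add: tree_section_append)
    then obtain P where "\<And>x. is_portrait G (tree_section g [x]) (P x)" by metis
    then show ?case by (meson is_portrait.intros)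
  qed
qed

lemma depth_eq_height: "is_portrait G g P \<Longrightarrow> depth G g = height P"
  unfolding depth_def by (metis is_portrait_unique the_equality)

lemma depth_eq_0_iff:
  assumes "contracting G" "g \<in> G"
  shows "depth G g = 0 \<longleftrightarrow> g \<in> nucleus G"
proof -
  obtain P where P: "is_portrait G g P" using is_portrait_exists[OF assms] by blast
  then show ?thesis unfolding depth_eq_height[OF P] by cases auto
qed

text \<open>Outside the nucleus this is the recursion for the height of a node. Inside the nucleus
  both sides are true, the right one because the nucleus is closed under sections.\<close>

lemma depth_le_Suc_iff:
  assumes "contracting G" "g \<in> G"
  shows "depth G g \<le> Suc n \<longleftrightarrow> (\<forall>x. depth G (psi g x) \<le> n)"
proof -
  obtain P where P: "is_portrait G g P" using is_portrait_exists[OF assms] by blast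
  then show ?thesis
  proof cases
    case leaf
    then have "psi g x \<in> nucleus G" for x
      using nucleus_section[OF assms(1)] by (simp add: psi_def)
    moreover have "nucleus G \<subseteq> G"
      using nucleus_least(1)[OF assms(1)] by (simp add: contracts_to_def)
    ultimately have "depth G (psi g x) = 0" for x
      using depth_eq_0_iff[OF assms(1)] by blast
    moreover have "depth G g = 0" using depth_eq_0_iff[OF assms] leaf by blast
    ultimately show ?thesis by simp
  next
    case (node Q)
    then have "depth G (psi g x) = height (Q x)" for x
      by (simp add: psi_def depth_eq_height)
    moreover have "depth G g = Suc (Max (range (\<lambda>x. height (Q x))))"
      using depth_eq_height[OF P] node by simp
    ultimately show ?thesis by simp
  qed
qed

lemma psi_closed:
  assumes "contracting G" "g \<in> G"
  shows "psi g x \<in> G"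
  using assms by (simp add: contracting_def self_similar_def psi_def)

text \<open>Starting from the finite nucleus, an element one level deeper is determined by one of
  finitely many root maps and a finite tuple of shallower elements. Finiteness matters for the sums
  below, as \<open>card\<close> is 0 on infinite sets.\<close>

lemma finite_depth_le:
  fixes G :: "('x::finite) tmap set"
  assumes "contracting G" "G \<subseteq> carrier AutT"
  shows "finite {g \<in> G. depth G g \<le> n}"
proof (induction n)
  case 0
  have "{g \<in> G. depth G g \<le> 0} \<subseteq> nucleus G" using depth_eq_0_iff[OF assms(1)] by auto
  then show ?case
    using nucleus_least(1)[OF assms(1)] finite_subset by (auto simp: contracts_to_def)
next
  case (Suc n)
  let ?f = "\<lambda>g. (root_perm g, psi g)" and ?S = "{g \<in> G. depth G g \<le> n}"
  have "finite (UNIV \<times> (UNIV \<rightarrow>\<^sub>E ?S) :: (('x \<Rightarrow> 'x) \<times> ('x \<Rightarrow> 'x tmap)) set)"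
    using Suc by (intro finite_cartesian_product finite_PiE) auto
  moreover have "?f ` {g \<in> G. depth G g \<le> Suc n} \<subseteq> UNIV \<times> (UNIV \<rightarrow>\<^sub>E ?S)"
    using psi_closed[OF assms(1)] depth_le_Suc_iff[OF assms(1)] by auto
  ultimately have "finite (?f ` {g \<in> G. depth G g \<le> Suc n})"
    by (rule rev_finite_subset)
  moreover have "inj_on ?f {g \<in> G. depth G g \<le> Suc n}"
    using assms(2) by (auto intro!: inj_onI tree_automorphism_eqI)
  ultimately show ?case by (rule finite_imageD)
qed

section \<open>First level sections on a coset of the preimage\<close>

lemma bij_betw_psi_l_coset:
  fixes G K :: "('x::finite) tmap set"
  assumes G: "subgroup G AutT" and branch: "regular_branch_over G K"
    and a: "a \<in> G"
  shows "bij_betw psi (a <#\<^bsub>AutT\<^esub> psi_preimage G K) (\<Pi>\<^sub>E x\<in>UNIV. psi a x <#\<^bsub>AutT\<^esub> K)"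
proof -
  have Gc: "G \<subseteq> carrier AutT" using G by (rule subgroup.subset)
  note st = st1_iff_root_perm[OF Gc]
  have aut_a: "tree_automorphism a" using a Gc by auto
  have H: "h \<in> G" "tree_automorphism h" "root_perm h = id" "\<And>x. psi h x \<in> K"
    if "h \<in> psi_preimage G K" for h
    using that Gc by (auto simp: psi_preimage_def dpower_def st)
  have bij: "bij (root_perm a)"
    using inj_root_perm[OF aut_a] by (simp add: finite_UNIV_inj_surj bij_def)
  show ?thesis
    unfolding bij_betw_def
  proof (intro conjI subset_antisym subsetI)
    show "inj_on psi (a <#\<^bsub>AutT\<^esub> psi_preimage G K)"
    proof (rule inj_onI)
      fix g g'
      assume "g \<in> a <#\<^bsub>AutT\<^esub> psi_preimage G K" "g' \<in> a <#\<^bsub>AutT\<^esub> psi_preimage G K"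
        and eq: "psi g = psi g'"
      then obtain h h' where h: "h \<in> psi_preimage G K" "g = a \<otimes>\<^bsub>AutT\<^esub> h"
        and h': "h' \<in> psi_preimage G K" "g' = a \<otimes>\<^bsub>AutT\<^esub> h'"
        by (auto simp: l_coset_def)
      show "g = g'"
      proof (rule tree_automorphism_eqI[OF _ _ _ eq])
        show "tree_automorphism g" "tree_automorphism g'"
          using h h' H(2) aut_a by (simp_all add: tree_automorphism_comp)
        \<comment> \<open>Elements of the preimage fix level 1, so the whole coset shares the root
          permutation of \<open>a\<close> and only the sections can differ.\<close>
        show "root_perm g = root_perm g'"
          unfolding h(2) h'(2)
          using h(1) h'(1) H(2,3) by (intro ext) (simp add: root_perm_mult[OF aut_a] del: mult_AutT)
      qed
    qed
  next
    fix f
    assume "f \<in> psi ` (a <#\<^bsub>AutT\<^esub> psi_preimage G K)"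
    then obtain h where h: "h \<in> psi_preimage G K" "f = psi (a \<otimes>\<^bsub>AutT\<^esub> h)"
      by (auto simp: l_coset_def)
    have "f x = psi a x \<otimes>\<^bsub>AutT\<^esub> psi h (root_perm a x)" for x
      using psi_mult[OF aut_a H(2)[OF h(1)]] h(2) by simp
    then show "f \<in> (\<Pi>\<^sub>E x\<in>UNIV. psi a x <#\<^bsub>AutT\<^esub> K)"
      using H(4)[OF h(1)] by (auto simp: l_coset_def simp del: mult_AutT)
  next
    fix f
    assume "f \<in> (\<Pi>\<^sub>E x\<in>UNIV. psi a x <#\<^bsub>AutT\<^esub> K)"
    then have "f x \<in> psi a x <#\<^bsub>AutT\<^esub> K" for x by blast
    then have "\<exists>c\<in>K. f x = psi a x \<otimes>\<^bsub>AutT\<^esub> c" for x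
      by (simp add: l_coset_def del: mult_AutT)
    then obtain c where c: "\<And>x. c x \<in> K" "\<And>x. f x = psi a x \<otimes>\<^bsub>AutT\<^esub> c x"
      by metis
    \<comment> \<open>The section of the product at \<open>x\<close> involves the section of
      \<open>h\<close> at \<open>root_perm a x\<close>. Composing with the inverse permutation
      therefore puts \<open>c x\<close> where it is read.\<close>
    have "c \<circ> inv_into UNIV (root_perm a) \<in> dpower K" using c(1) by (simp add: dpower_def)
    then obtain h where h: "h \<in> st1 G" "psi h = c \<circ> inv_into UNIV (root_perm a)"
      using branch unfolding regular_branch_over_def by auto
    then have hH: "h \<in> psi_preimage G K"
      using c(1) by (simp add: psi_preimage_def dpower_def)
    have "psi (a \<otimes>\<^bsub>AutT\<^esub> h) x = f x" for x
      using psi_mult[OF aut_a H(2)[OF hH], of x] c(2)[of x] h(2) bij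
      by (simp add: bij_is_inj inv_f_f del: mult_AutT)
    then have "f = psi (a \<otimes>\<^bsub>AutT\<^esub> h)" by (rule ext[THEN sym])
    moreover have "a \<otimes>\<^bsub>AutT\<^esub> h \<in> a <#\<^bsub>AutT\<^esub> psi_preimage G K"
      using hH by (auto simp: l_coset_def)
    ultimately show "f \<in> psi ` (a <#\<^bsub>AutT\<^esub> psi_preimage G K)" by blast
  qed
qed

lemma card_depth_le_Suc_l_coset:
  fixes G K :: "('x::finite) tmap set"
  assumes G: "subgroup G AutT" and branch: "regular_branch_over G K"
    and contr: "contracting G" and a: "a \<in> G"
  shows "card {g \<in> a <#\<^bsub>AutT\<^esub> psi_preimage G K. depth G g \<le> Suc n} =
    (\<Prod>x\<in>UNIV. coset_growth G K n (psi a x))"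
proof -
  let ?C = "a <#\<^bsub>AutT\<^esub> psi_preimage G K"
  let ?P = "\<Pi>\<^sub>E x\<in>UNIV. {g \<in> psi a x <#\<^bsub>AutT\<^esub> K. depth G g \<le> n}"
  have "psi_preimage G K \<subseteq> G" by (auto simp: psi_preimage_def st1_def)
  then have CG: "?C \<subseteq> G"
    using a subgroup.m_closed[OF G] by (fastforce simp: l_coset_def)
  note b = bij_betw_psi_l_coset[OF G branch a]
  have "psi ` {g \<in> ?C. depth G g \<le> Suc n} = {f \<in> psi ` ?C. \<forall>x. depth G (f x) \<le> n}"
    using CG depth_le_Suc_iff[OF contr] by auto
  \<comment> \<open>With index set \<open>UNIV\<close>, \<open>\<Pi>\<^sub>E\<close> is the full
    product, so a bound on every coordinate is a bound inside every factor.\<close>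
  also have "\<dots> = ?P"
    unfolding bij_betw_imp_surj_on[OF b] by (auto simp: PiE_iff)
  finally have "bij_betw psi {g \<in> ?C. depth G g \<le> Suc n} ?P"
    using bij_betw_subset[OF b] by (metis (no_types, lifting) mem_Collect_eq subsetI)
  then have "card {g \<in> ?C. depth G g \<le> Suc n} = card ?P" by (rule bij_betw_same_card)
  also have "\<dots> = (\<Prod>x\<in>UNIV. coset_growth G K n (psi a x))"
    by (simp add: card_PiE coset_growth_def)
  finally show ?thesis .
qed

text \<open>Finiteness is asked of the filtered union rather than of the pieces: cosets may be
  infinite, while their elements of bounded depth are finite in number.\<close>

lemma card_Collect_disjoint_UN:
  assumes "finite I" "disjoint_family_on B I" "finite {x \<in> (\<Union>i\<in>I. B i). P x}"
  shows "card {x \<in> (\<Union>i\<in>I. B i). P x} = (\<Sum>i\<in>I. card {x \<in> B i. P x})"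
proof -
  have "{x \<in> (\<Union>i\<in>I. B i). P x} = (\<Union>i\<in>I. {x \<in> B i. P x})" by blast
  moreover have "finite {x \<in> B i. P x}" if "i \<in> I" for i
    using that by (intro finite_subset[OF _ assms(3)]) blast
  moreover have "{x \<in> B i. P x} \<inter> {x \<in> B j. P x} = {}" if "i \<in> I" "j \<in> I" "i \<noteq> j" for i j
    using that assms(2) by (fastforce simp: disjoint_family_on_def)
  ultimately show ?thesis
    using assms(1) by (simp add: card_UN_disjoint)
qed

section \<open>The recursion for the growth functions and its initial values\<close>

theorem mainTheorem5:
  fixes G K :: "('x::finite) tmap set"
    and k l :: nat
    and t s :: "nat \<Rightarrow> 'x tmap"
    and \<tau> :: "nat \<Rightarrow> nat \<Rightarrow> 'x \<Rightarrow> 'x tmap"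
  assumes "subgroup G AutT"
    and "finitely_generated G"
    and "contracting G"
    and "regular_branch_over G K"
    and "card (rcosets\<^bsub>AutT\<lparr>carrier := G\<rparr>\<^esub> K) = k"
    and "left_transversal G K k t"
    and "left_transversal K (psi_preimage G K) l s"
    and "\<And>i j r. i \<in> {1..k} \<Longrightarrow> j \<in> {1..l} \<Longrightarrow>
           \<tau> i j r \<in> t ` {1..k} \<and>
           tree_section (t i \<otimes>\<^bsub>AutT\<^esub> s j) [r] \<in> \<tau> i j r <#\<^bsub>AutT\<^esub> K"
  shows "(\<forall>n. \<forall>i\<in>{1..k}. coset_growth G K (n + 1) (t i) =
            (\<Sum>j = 1..l. \<Prod>r\<in>UNIV. coset_growth G K n (\<tau> i j r)))
       \<and> (\<forall>n. growth G (n + 1) =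
            (\<Sum>i = 1..k. \<Sum>j = 1..l. \<Prod>r\<in>UNIV. coset_growth G K n (\<tau> i j r)))
       \<and> (\<forall>i\<in>{1..k}. coset_growth G K 0 (t i) = card (nucleus G \<inter> (t i <#\<^bsub>AutT\<^esub> K)))
       \<and> growth G 0 = card (nucleus G)"
proof -
  interpret A: group AutT by (rule group_AutT)
  note G = assms(1) and contr = assms(3) and branch = assms(4)
  let ?H = "psi_preimage G K"
  have Gc: "G \<subseteq> carrier AutT" using G by (rule subgroup.subset)
  have KG: "subgroup K (AutT\<lparr>carrier := G\<rparr>)"
    using branch by (simp add: regular_branch_over_def normal_imp_subgroup)
  then have K: "subgroup K AutT" using G by (rule A.incl_subgroup[rotated])
  have "K \<subseteq> G" using subgroup.subset[OF KG] by simp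
  have Kc: "K \<subseteq> carrier AutT" using K by (rule subgroup.subset)
  have H: "subgroup ?H AutT" using G K by (rule subgroup_psi_preimage)
  have HK: "?H \<subseteq> K" using Gc branch by (rule psi_preimage_subset)
  note partG = left_transversal_partition[OF G K \<open>K \<subseteq> G\<close> assms(6)]
  note partK = left_transversal_partition[OF K H HK assms(7)]
  have tG: "t i \<in> G" if "i \<in> {1..k}" for i
    using that assms(6) by (auto simp: left_transversal_def)
  have sK: "s j \<in> K" if "j \<in> {1..l}" for j
    using that assms(7) by (auto simp: left_transversal_def)
  have fin: "finite {g \<in> G. depth G g \<le> n}" for n
    using contr Gc by (rule finite_depth_le)
  have step: "coset_growth G K (n + 1) (t i) =
      (\<Sum>j = 1..l. \<Prod>r\<in>UNIV. coset_growth G K n (\<tau> i j r))" if i: "i \<in> {1..k}" for n i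
  proof -
    have "t i <#\<^bsub>AutT\<^esub> K \<subseteq> G" using partG(1) i by blast
    then have fin_i: "finite {g \<in> t i <#\<^bsub>AutT\<^esub> K. depth G g \<le> Suc n}"
      by (intro finite_subset[OF _ fin[of "Suc n"]]) blast
    have "t i \<in> carrier AutT" "?H \<subseteq> carrier AutT" "s ` {1..l} \<subseteq> carrier AutT"
      using tG[OF i] sK Gc Kc HK by blast+
    \<comment> \<open>The coset of \<open>t i\<close> is refined into translates of the cosets in
      \<open>K\<close>, on each of which the count is a product.\<close>
    note part = l_coset_partition[OF this(1) Kc this(2,3) partK]
    have "coset_growth G K (n + 1) (t i) =
        (\<Sum>j = 1..l. card {g \<in> (t i \<otimes>\<^bsub>AutT\<^esub> s j) <#\<^bsub>AutT\<^esub> ?H. depth G g \<le> Suc n})"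
      using card_Collect_disjoint_UN[OF _ part(2), where P = "\<lambda>g. depth G g \<le> Suc n"] fin_i
      unfolding coset_growth_def part(1) by simp
    also have "\<dots> = (\<Sum>j = 1..l. \<Prod>r\<in>UNIV. coset_growth G K n (\<tau> i j r))"
    proof (rule sum.cong[OF refl])
      fix j
      assume j: "j \<in> {1..l}"
      let ?a = "t i \<otimes>\<^bsub>AutT\<^esub> s j"
      have a: "?a \<in> G" using tG[OF i] sK[OF j] \<open>K \<subseteq> G\<close> subgroup.m_closed[OF G] by blast
      \<comment> \<open>The section and \<open>\<tau> i j r\<close> represent the same coset of
        \<open>K\<close>, so the former may be replaced by the latter in the product.\<close>
      have "psi ?a r <#\<^bsub>AutT\<^esub> K = \<tau> i j r <#\<^bsub>AutT\<^esub> K" for r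
      proof -
        have "\<tau> i j r \<in> t ` {1..k}" and r: "psi ?a r \<in> \<tau> i j r <#\<^bsub>AutT\<^esub> K"
          using assms(8)[OF i j, of r] by (simp_all add: psi_def del: mult_AutT)
        then have "\<tau> i j r \<in> carrier AutT" using tG subsetD[OF Gc] by fastforce
        then show ?thesis using A.l_repr_independence[OF r _ K] by simp
      qed
      then show "card {g \<in> ?a <#\<^bsub>AutT\<^esub> ?H. depth G g \<le> Suc n} =
          (\<Prod>r\<in>UNIV. coset_growth G K n (\<tau> i j r))"
        using card_depth_le_Suc_l_coset[OF G branch contr a, of n]
        by (simp add: coset_growth_def del: mult_AutT)
    qed
    finally show ?thesis .
  qed
  \<comment> \<open>Adding over the cosets of \<open>K\<close> reduces the recursion for
    \<open>G\<close> to the one for single cosets.\<close>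
  have total: "growth G n = (\<Sum>i = 1..k. coset_growth G K n (t i))" for n
    using card_Collect_disjoint_UN[OF _ partG(2), where P = "\<lambda>g. depth G g \<le> n"] fin[of n]
    unfolding partG(1)[symmetric] by (simp add: growth_def coset_growth_def)
  have NG: "nucleus G \<subseteq> G" using nucleus_least(1)[OF contr] by (simp add: contracts_to_def)
  have "{g \<in> G. depth G g \<le> 0} = nucleus G" using depth_eq_0_iff[OF contr] NG by auto
  then have growth0: "growth G 0 = card (nucleus G)" by (simp add: growth_def)
  have coset0: "coset_growth G K 0 (t i) = card (nucleus G \<inter> (t i <#\<^bsub>AutT\<^esub> K))"
    if "i \<in> {1..k}" for i
  proof -
    have "t i <#\<^bsub>AutT\<^esub> K \<subseteq> G" using partG(1) that by blast
    then have "{g \<in> t i <#\<^bsub>AutT\<^esub> K. depth G g \<le> 0} = nucleus G \<inter> (t i <#\<^bsub>AutT\<^esub> K)"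
      using depth_eq_0_iff[OF contr] by auto
    then show ?thesis by (simp add: coset_growth_def)
  qed
  show ?thesis
    using step total growth0 coset0 by simp
qed

end
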